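(* Let $\mathcal L$ be a finite modular complemented lattice. Let $\mathcal Z\subseteq\mathcal L$ be a lattice for the inherited order, and let $\lambda:\mathcal Z\to\mathbb R_{\ge0}$ and $f:\mathcal A(\mathcal L)\to\mathbb R_{\ge0}$ be such that $(\mathcal Z,\lambda,f)$ satisfies (Z1). Let $X\in\mathcal L$ and let $a_1,a_2\in\mathcal A(\mathcal L)\setminus\mathcal A(X)$. Suppose $Z_1\in\mathcal Z(X\vee a_1)$ satisfies (Z1) for $X\vee a_1$, and $Z_2\in\mathcal Z(X\vee a_2)$ satisfies (Z1) for $X\vee a_2$. Let $Z_k^c\in\mathbf C(Z_k;X\vee a_k)$ for $k=1,2$. Then $$\mu_f((X\vee a_1)\wedge Z_1^c)+\mu_f((X\vee a_2)\wedge Z_2^c)\ge\mu_f(X\wedge(Z_1\wedge Z_2)^c)+\mu_f((X\vee a_1\vee a_2)\wedge(Z_1\vee Z_2)^c)$$ for some $(Z_1\vee Z_2)^c\in\mathbf C(Z_1\vee Z_2;X\vee a_1\vee a_2)$ and some $(Z_1\wedge Z_2)^c\in\mathbf C(Z_1\wedge Z_2;X)$. Here $\wedge,\vee$ are the operations of $\mathcal L$.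
   Context: $\mathcal L$ has least element $\mathbf 0$ and greatest element $\mathbf 1$. $\mathrm h$ is the height. $\mathcal A(X)$ is the set of atoms below $X$, and $\mathcal A(\mathcal L)$ the set of all atoms. Complements: $\mathbf C(A)=\{C: C\wedge A=\mathbf 0,C\vee A=\mathbf 1\}$ and $\mathbf C(A;B)=\{A^c\in\mathbf C(A):(A^c\wedge B)\vee(A\wedge B)=B\}$. $\mu_f(\mathbf 0)=0$, and for $A\ne\mathbf 0$, $\mu_f(A)=\min\{\sum_{x\in\beta}f(x):\beta\subseteq\mathcal A(A),|\beta|=\mathrm h(A),\bigvee\beta=A\}$. $g$ is quasi-modular on $[\mathbf 0,X]$ if for every $Y\le X$ there is $Y^c\in\mathbf C(Y)$ with $g(X)=g(Y)+g(X\wedge Y^c)$. For $Y\in\mathcal L$: - $\rho(Y)=\min\{\lambda(Z)+\mu_f(Y\wedge Z^c):Z\in\mathcal Z, Z^c\in\mathbf C(Z;Y)\}$; - $\mathcal Z(Y)$ is the set of $Z\in\mathcal Z$ with $\lambda(Z)+\mu_f(Y\wedge Z^c)=\rho(Y)$ for some $Z^c\in\mathbf C(Z;Y)$. $Z\in\mathcal Z(Y)$ satisfies (Z1) for $Y$ if (i) $\lambda(Z)+\mu_f(Y\wedge Z^c)=\rho(Y)$ for every $Z^c\in\mathbf C(Z;Y)$, and (ii) $\mu_f$ is quasi-modular on $[\mathbf 0,Y\wedge Z^c]$ for every $Z^c\in\mathbf C(Z;Y)$. Axiom (Z1): for every $Y\in\mathcal L$ some $Z\in\mathcal Z(Y)$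 satisfies (Z1) for $Y$. *)

theory Defs
  imports Complex_Main "HOL-Library.Finite_Lattice"
begin

definition complements :: "'a::bounded_lattice \<Rightarrow> 'a set" where
  "complements A = {C. inf C A = bot \<and> sup C A = top}"

definition rel_complements :: "'a::bounded_lattice \<Rightarrow> 'a \<Rightarrow> 'a set" where
  "rel_complements A B = {Ac \<in> complements A. sup (inf Ac B) (inf A B) = B}"

text \<open>Every finite lattice carries exactly one \<^class>\<open>finite_lattice_complete\<close> structure:
  that class merely adds names for the bounds and for joins and meets of sets. The library class
  of complemented lattices is not used because it fixes a complementation operation, whereas here
  complements are only required to exist.\<close>

class finite_modular_complemented_lattice = finite_lattice_complete +
  assumes modular_law: "x \<le> z \<Longrightarrow> sup x (inf y z) = inf (sup x y) z"
    and complement_exists: "\<exists>c. inf c x = bot \<and> sup c x = top"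

definition all_atoms :: "'a::bounded_lattice set" where
  "all_atoms = {a. a \<noteq> bot \<and> (\<forall>x. x < a \<longrightarrow> x = bot)}"

definition atoms_below :: "'a::bounded_lattice \<Rightarrow> 'a set" where
  "atoms_below X = {a \<in> all_atoms. a \<le> X}"

definition height :: "'a::finite_lattice_complete \<Rightarrow> nat" where
  "height A = Max {card C - 1 | C.
     C \<noteq> {} \<and> C \<subseteq> {bot..A} \<and> Complete_Partial_Order.chain (\<le>) C}"

definition mu :: "('a::finite_lattice_complete \<Rightarrow> real) \<Rightarrow> 'a \<Rightarrow> real" where
  "mu f A = (if A = bot then 0
     else Min {\<Sum>x\<in>\<beta>. f x | \<beta>. \<beta> \<subseteq> atoms_below A \<and> card \<beta> = height A \<and> Sup \<beta> = A})"

definition quasi_modular_below :: "('a::bounded_lattice \<Rightarrow> real) \<Rightarrow> 'a \<Rightarrow> bool" where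
  "quasi_modular_below g X \<longleftrightarrow>
     (\<forall>Y\<le>X. \<exists>Yc\<in>complements Y. g X = g Y + g (inf X Yc))"

text \<open>Joins and meets are taken within \<open>S\<close>; they may differ from those of the ambient
  lattice.\<close>

definition lattice_for_inherited_order :: "'a::order set \<Rightarrow> bool" where
  "lattice_for_inherited_order S \<longleftrightarrow> (\<forall>x\<in>S. \<forall>y\<in>S.
     (\<exists>j\<in>S. x \<le> j \<and> y \<le> j \<and> (\<forall>u\<in>S. x \<le> u \<and> y \<le> u \<longrightarrow> j \<le> u)) \<and>
     (\<exists>m\<in>S. m \<le> x \<and> m \<le> y \<and> (\<forall>l\<in>S. l \<le> x \<and> l \<le> y \<longrightarrow> l \<le> m)))"

definition rho ::
  "'a::finite_lattice_complete set \<Rightarrow> ('a \<Rightarrow> real) \<Rightarrow> ('a \<Rightarrow> real) \<Rightarrow> 'a \<Rightarrow> real" where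
  "rho ZZ lam f Y = Min {lam Z + mu f (inf Y Zc) | Z Zc. Z \<in> ZZ \<and> Zc \<in> rel_complements Z Y}"

definition rho_minimizers ::
  "'a::finite_lattice_complete set \<Rightarrow> ('a \<Rightarrow> real) \<Rightarrow> ('a \<Rightarrow> real) \<Rightarrow> 'a \<Rightarrow> 'a set" where
  "rho_minimizers ZZ lam f Y =
     {Z \<in> ZZ. \<exists>Zc\<in>rel_complements Z Y. lam Z + mu f (inf Y Zc) = rho ZZ lam f Y}"

definition Z1_for ::
  "'a::finite_lattice_complete set \<Rightarrow> ('a \<Rightarrow> real) \<Rightarrow> ('a \<Rightarrow> real) \<Rightarrow> 'a \<Rightarrow> 'a \<Rightarrow> bool" where
  "Z1_for ZZ lam f Y Z \<longleftrightarrow>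
     (\<forall>Zc\<in>rel_complements Z Y. lam Z + mu f (inf Y Zc) = rho ZZ lam f Y) \<and>
     (\<forall>Zc\<in>rel_complements Z Y. quasi_modular_below (mu f) (inf Y Zc))"

definition axiom_Z1 ::
  "'a::finite_lattice_complete set \<Rightarrow> ('a \<Rightarrow> real) \<Rightarrow> ('a \<Rightarrow> real) \<Rightarrow> bool" where
  "axiom_Z1 ZZ lam f \<longleftrightarrow> (\<forall>Y. \<exists>Z\<in>rho_minimizers ZZ lam f Y. Z1_for ZZ lam f Y Z)"

end

theory Submission
  imports Defs
begin

text \<open>
  In a finite modular complemented lattice the atoms form a matroid whose rank is the height, and
  \<open>mu f A\<close> is the minimum weight of a basis of \<open>A\<close>. If \<open>mu f\<close> is quasi-modular below \<open>B\<close>, then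
  every atom below \<open>B\<close> lies in a minimum weight basis of \<open>B\<close>, which forces \<open>mu f\<close> to be monotone
  below \<open>B\<close>. Hence, if \<open>Z\<close> satisfies (Z1) for \<open>Y\<close> and \<open>inf Y Z \<le> N \<le> Y\<close>, then for each \<open>P \<le> N\<close>
  disjoint from \<open>Z\<close> there is a complement \<open>J\<close> of \<open>N\<close> in \<open>Y\<close> such that \<open>mu f P + mu f J\<close> is at most
  the common value of \<open>mu f\<close> on the complements of \<open>inf Y Z\<close> in \<open>Y\<close>.

  For the theorem take complements \<open>P\<close> of \<open>inf X (inf Z1 Z2)\<close> in \<open>inf X Z1\<close> and \<open>Q\<close> of
  \<open>inf X Z1\<close> in \<open>X\<close>, so that \<open>sup P Q\<close> is a complement of \<open>inf X (inf Z1 Z2)\<close> in \<open>X\<close>. Splitting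
  off \<open>P\<close> in \<open>sup X a2\<close> leaves a complement \<open>J2\<close> of the trace of \<open>sup Z1 Z2\<close> there. Either \<open>J2\<close>
  is still a complement after adjoining \<open>a1\<close>, or it has to be enlarged by a complement of \<open>X\<close> in
  \<open>sup X a1\<close>, whose weight is paid for by splitting off \<open>Q\<close> in \<open>sup X a1\<close>.
\<close>

section \<open>Modular complemented lattices\<close>

lemma modular_disjoint:
  fixes x :: "'a::finite_modular_complemented_lattice"
  assumes "x \<le> z" "inf y z = bot"
  shows "inf (sup x y) z = x"
  using modular_law[OF assms(1), of y] assms(2) by simp

lemma relative_complement_exists:
  fixes x :: "'a::finite_modular_complemented_lattice"
  assumes "x \<le> y"
  obtains z where "z \<le> y" "inf x z = bot" "sup x z = y"
proof -
  obtain c where c: "inf c x = bot" "sup c x = top"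
    using complement_exists by blast
  have "sup x (inf c y) = y"
    using modular_law[OF assms, of c] c by (simp add: sup_commute)
  moreover have "inf x (inf c y) = bot"
    by (metis c(1) inf_bot_left inf_commute inf_left_commute)
  ultimately show ?thesis
    using that[of "inf c y"] by simp
qed

text \<open>A modular lattice contains no pentagon. In the height count this makes meets with
  \<open>A\<close> injective on part of a chain.\<close>

lemma modular_cancel:
  fixes x :: "'a::finite_modular_complemented_lattice"
  assumes "x \<le> y" "inf x A = inf y A" "sup x A = sup y A"
  shows "x = y"
proof -
  have "x = sup x (inf A y)"
    using assms(2) by (metis inf_commute sup_inf_absorb)
  also have "\<dots> = inf (sup x A) y"
    by (rule modular_law[OF assms(1)])
  also have "\<dots> = y"
    using assms(3) by (simp add: inf_absorb2)
  finally show ?thesis .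
qed

lemma inf_atom:
  assumes "a \<in> all_atoms" "\<not> a \<le> x"
  shows "inf x a = bot"
  using assms unfolding all_atoms_def
  by (metis (mono_tags, lifting) inf.cobounded1 inf.cobounded2 mem_Collect_eq
      order.not_eq_order_implies_strict)

lemma exists_atom_le:
  fixes x :: "'a::finite_lattice_complete"
  assumes "x \<noteq> bot"
  obtains a where "a \<in> all_atoms" "a \<le> x"
proof -
  have "finite {y. y \<noteq> bot \<and> y \<le> x}" "{y. y \<noteq> bot \<and> y \<le> x} \<noteq> {}"
    using assms by auto
  then obtain a where "a \<in> {y. y \<noteq> bot \<and> y \<le> x}"
    and "\<And>b. b \<in> {y. y \<noteq> bot \<and> y \<le> x} \<Longrightarrow> b \<le> a \<Longrightarrow> a = b"
    using finite_has_minimal by (metis (no_types, lifting))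
  then have "a \<in> all_atoms" "a \<le> x"
    unfolding all_atoms_def
    by (auto, metis less_le order.trans)
  then show ?thesis by (rule that)
qed

text \<open>The exchange property of the matroid of atoms. If \<open>c\<close> were not below
  \<open>sup x b\<close>, the meet of \<open>sup x c\<close> and \<open>sup x b\<close> would be
  \<open>x\<close>, although \<open>b\<close> is below both.\<close>

lemma sup_atom_exchange:
  fixes x :: "'a::finite_modular_complemented_lattice"
  assumes "c \<in> all_atoms" "b \<le> sup x c" "\<not> b \<le> x"
  shows "sup x b = sup x c"
proof -
  have "c \<le> sup x b"
  proof (rule ccontr)
    assume "\<not> c \<le> sup x b"
    then have "inf c (sup x b) = bot"
      by (metis inf_atom[OF assms(1)] inf_commute)
    then have "inf (sup x c) (sup x b) = x"
      by (intro modular_disjoint) auto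
    then show False
      using assms by (metis inf.boundedI sup_ge2)
  qed
  then show ?thesis
    using assms(2) by (simp add: order.antisym)
qed

text \<open>Relative complements make the lattice atomistic: any atom below a complement of
  \<open>inf x y\<close> in \<open>y\<close> serves.\<close>

lemma exists_atom_le_not_le:
  fixes x y :: "'a::finite_modular_complemented_lattice"
  assumes "\<not> y \<le> x"
  obtains a where "a \<in> all_atoms" "a \<le> y" "\<not> a \<le> x"
proof -
  obtain z where z: "z \<le> y" "inf (inf x y) z = bot" "sup (inf x y) z = y"
    using relative_complement_exists[of "inf x y" y] by auto
  have "z \<noteq> bot"
    using z assms by (metis inf.absorb_iff2 sup_bot_right inf_commute)
  then obtain a where a: "a \<in> all_atoms" "a \<le> z"
    using exists_atom_le by blast
  have "\<not> a \<le> x"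
  proof
    assume "a \<le> x"
    then have "a \<le> inf (inf x y) z"
      using a(2) z(1) by (meson le_inf_iff order.trans)
    then show False
      using a z unfolding all_atoms_def by (simp add: bot_unique)
  qed
  then show ?thesis
    using that a z by (meson order.trans)
qed

text \<open>A complement of an atom in \<open>x\<close> is strictly smaller than \<open>x\<close>,
  so every element is reached from \<open>bot\<close> by adjoining atoms.\<close>

lemma atom_induct [case_names bot sup_atom]:
  fixes x :: "'a::finite_modular_complemented_lattice"
  assumes bot: "P bot"
    and step: "\<And>x a. P x \<Longrightarrow> a \<in> all_atoms \<Longrightarrow> \<not> a \<le> x \<Longrightarrow> P (sup x a)"
  shows "P x"
proof (induction "card {..x}" arbitrary: x rule: less_induct)
  case less
  show ?case
  proof (cases "x = bot")
    case True
    then show ?thesis using bot by simp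
  next
    case False
    then obtain a where a: "a \<in> all_atoms" "a \<le> x"
      using exists_atom_le by blast
    obtain y where y: "y \<le> x" "inf a y = bot" "sup a y = x"
      using relative_complement_exists[OF a(2)] by blast
    have na: "\<not> a \<le> y"
      using y a unfolding all_atoms_def by (auto simp: inf_absorb1)
    have "{..y} \<subset> {..x}"
      using y a na by (metis atMost_subset_iff psubsetI)
    then have "P y"
      using less psubset_card_mono[of "{..x}"] by simp
    then show ?thesis
      using step[OF _ a(1) na] y by (simp add: sup_commute)
  qed
qed

section \<open>Height and bases\<close>

lemma height_ge:
  fixes A :: "'a::finite_lattice_complete"
  assumes "C \<noteq> {}" "C \<subseteq> {bot..A}" "Complete_Partial_Order.chain (\<le>) C"
  shows "card C - 1 \<le> height A"
  unfolding height_def by (rule Max_ge) (use assms in auto)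

lemma height_attained:
  fixes A :: "'a::finite_lattice_complete"
  obtains C where "C \<noteq> {}" "C \<subseteq> {bot..A}" "Complete_Partial_Order.chain (\<le>) C"
    "height A = card C - 1"
proof -
  let ?S = "{card C - 1 | C. C \<noteq> {} \<and> C \<subseteq> {bot..A} \<and> Complete_Partial_Order.chain (\<le>) C}"
  have "card {bot::'a} - 1 \<in> ?S"
    by (intro CollectI exI[of _ "{bot}"]) (auto simp: chain_def)
  then have "?S \<noteq> {}" by blast
  then have "height A \<in> ?S"
    unfolding height_def by (intro Max_in) auto
  then show ?thesis using that by blast
qed

lemma height_bot [simp]: "height (bot::'a::finite_lattice_complete) = 0"
proof -
  obtain C :: "'a set" where "C \<noteq> {}" "C \<subseteq> {bot..bot}" "height (bot::'a) = card C - 1"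
    by (rule height_attained)
  then show ?thesis
    by (metis atLeastAtMost_singleton card.empty card.insert diff_self_eq_0 finite.emptyI
        insert_absorb insert_not_empty subset_singletonD One_nat_def)
qed

text \<open>Meeting a chain below \<open>sup A a\<close> with \<open>A\<close> identifies at most two of its members:
  a pair with the same meet has different joins with \<open>A\<close>, so one lies below \<open>A\<close> and the
  other does not.\<close>

lemma height_sup_atom:
  fixes A :: "'a::finite_modular_complemented_lattice"
  assumes a: "a \<in> all_atoms" "\<not> a \<le> A"
  shows "height (sup A a) = Suc (height A)"
proof (rule antisym)
  obtain C where C: "C \<noteq> {}" "C \<subseteq> {bot..A}" "Complete_Partial_Order.chain (\<le>) C"
    "height A = card C - 1"
    by (rule height_attained)
  have "sup A a \<notin> C"
    using C(2) a by (metis atLeastAtMost_iff le_sup_iff subsetD)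
  have below: "x \<le> sup A a" if "x \<in> C" for x
    using that C(2) by (meson atLeastAtMost_iff le_supI1 subsetD)
  then have "Complete_Partial_Order.chain (\<le>) (insert (sup A a) C)"
    using C(3) unfolding chain_def by blast
  then have "card (insert (sup A a) C) - 1 \<le> height (sup A a)"
    using below by (intro height_ge) auto
  then show "Suc (height A) \<le> height (sup A a)"
    using C \<open>sup A a \<notin> C\<close> by (simp add: card_gt_0_iff)
next
  obtain C where C: "C \<noteq> {}" "C \<subseteq> {bot..sup A a}" "Complete_Partial_Order.chain (\<le>) C"
    "height (sup A a) = card C - 1"
    by (rule height_attained)
  define L where "L = {x \<in> C. x \<le> A}"
  define U where "U = {x \<in> C. \<not> x \<le> A}"
  let ?m = "\<lambda>x. inf x A"
  have cmp: "x \<le> y \<or> y \<le> x" if "x \<in> C" "y \<in> C" for x y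
    using C(3) that unfolding chain_def by blast
  have sup_U: "sup x A = sup A a" if "x \<in> U" for x
  proof -
    have "x \<le> sup A a" "\<not> x \<le> A"
      using that C(2) unfolding U_def by auto
    then show ?thesis
      by (subst sup_commute) (rule sup_atom_exchange[OF a(1)])
  qed
  have inj: "inj_on ?m U"
  proof (rule inj_onI)
    fix x y assume xy: "x \<in> U" "y \<in> U" "inf x A = inf y A"
    then have "sup x A = sup y A"
      using sup_U by simp
    moreover have "x \<le> y \<or> y \<le> x"
      using cmp xy unfolding U_def by blast
    ultimately show "x = y"
      using modular_cancel xy(3) by metis
  qed
  have LU: "x \<le> inf y A" if "x \<in> L" "y \<in> U" for x y
    using that cmp[of x y] unfolding L_def U_def by (auto intro: order.trans)
  \<comment> \<open>By \<open>LU\<close> each member of \<open>L\<close> is below each member of the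
    image of \<open>U\<close>, so two common members are below each other. Hence replacing
    \<open>U\<close> by its image costs the chain at most one member.\<close>
  have "card (L \<inter> ?m ` U) \<le> 1"
  proof (rule ccontr)
    assume "\<not> ?thesis"
    then obtain x y where xy: "x \<in> L \<inter> ?m ` U" "y \<in> L \<inter> ?m ` U" "x \<noteq> y"
      by (metis card_le_Suc0_iff_eq finite One_nat_def)
    then have "x \<le> y" "y \<le> x"
      using LU by blast+
    then show False
      using xy(3) by simp
  qed
  have CLU: "C = L \<union> U" "L \<inter> U = {}"
    unfolding L_def U_def by auto
  have "card C = card L + card (?m ` U)"
    using CLU inj by (simp add: card_Un_disjoint card_image)
  also have "\<dots> = card (L \<union> ?m ` U) + card (L \<inter> ?m ` U)"
    by (rule card_Un_Int) auto
  finally have cardC: "card C \<le> card (L \<union> ?m ` U) + 1"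
    using \<open>card (L \<inter> ?m ` U) \<le> 1\<close> by simp
  have "Complete_Partial_Order.chain (\<le>) (L \<union> ?m ` U)"
  proof (rule chainI)
    fix x y assume "x \<in> L \<union> ?m ` U" "y \<in> L \<union> ?m ` U"
    moreover have "inf u A \<le> inf v A \<or> inf v A \<le> inf u A" if "u \<in> U" "v \<in> U" for u v
      using that cmp[of u v] unfolding U_def by (auto intro: inf_mono le_infI1)
    moreover have "u \<le> v \<or> v \<le> u" if "u \<in> L" "v \<in> L" for u v
      using that cmp unfolding L_def by blast
    ultimately show "x \<le> y \<or> y \<le> x"
      using LU by blast
  qed
  moreover have "L \<union> ?m ` U \<noteq> {}"
    using C(1) CLU(1) by blast
  moreover have "L \<union> ?m ` U \<subseteq> {bot..A}"
    unfolding L_def by auto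
  ultimately have "card (L \<union> ?m ` U) - 1 \<le> height A"
    by (intro height_ge)
  then show "height (sup A a) \<le> Suc (height A)"
    using C(4) cardC by linarith
qed

lemma height_sup_disjoint:
  fixes A B :: "'a::finite_modular_complemented_lattice"
  assumes "inf A B = bot"
  shows "height (sup A B) = height A + height B"
  using assms
proof (induction B rule: atom_induct)
  case bot
  then show ?case by simp
next
  case (sup_atom B a)
  have "inf A B = bot"
    using sup_atom.prems by (metis bot_unique inf_mono order_refl sup_ge1)
  \<comment> \<open>Since \<open>A\<close> is disjoint from \<open>sup B a\<close>, the trace of
    \<open>sup B A\<close> on \<open>sup B a\<close> is only \<open>B\<close>.\<close>
  moreover have "\<not> a \<le> sup A B"
  proof
    assume "a \<le> sup A B"
    then have "sup B a \<le> inf (sup B A) (sup B a)"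
      by (simp add: sup_commute)
    also have "\<dots> = B"
      using sup_atom.prems by (intro modular_disjoint) auto
    finally show False
      using sup_atom.hyps by simp
  qed
  ultimately show ?case
    using sup_atom height_sup_atom by (metis add_Suc_right sup_assoc)
qed

text \<open>The bases of the matroid of atoms below \<open>A\<close>. A join of n atoms has height
  at most n, so the cardinality condition encodes independence.\<close>

definition is_basis :: "'a::finite_lattice_complete set \<Rightarrow> 'a \<Rightarrow> bool" where
  "is_basis \<beta> A \<longleftrightarrow> \<beta> \<subseteq> atoms_below A \<and> card \<beta> = height A \<and> Sup \<beta> = A"

lemma is_basis_union:
  fixes A B :: "'a::finite_modular_complemented_lattice"
  assumes "is_basis \<alpha> A" "is_basis \<beta> B" "inf A B = bot"
  shows "is_basis (\<alpha> \<union> \<beta>) (sup A B)" "\<alpha> \<inter> \<beta> = {}"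
proof -
  show disj: "\<alpha> \<inter> \<beta> = {}"
  proof (rule ccontr)
    assume "\<alpha> \<inter> \<beta> \<noteq> {}"
    then obtain x where "x \<in> all_atoms" "x \<le> A" "x \<le> B"
      using assms unfolding is_basis_def atoms_below_def by auto
    then show False
      using assms(3) unfolding all_atoms_def
      by (metis (mono_tags, lifting) bot_unique le_inf_iff mem_Collect_eq)
  qed
  show "is_basis (\<alpha> \<union> \<beta>) (sup A B)"
    using assms disj height_sup_disjoint[OF assms(3)]
    unfolding is_basis_def atoms_below_def
    by (auto simp: card_Un_disjoint Sup_union_distrib intro: le_supI1 le_supI2)
qed

lemma height_atom:
  fixes a :: "'a::finite_modular_complemented_lattice"
  assumes "a \<in> all_atoms"
  shows "height a = 1"
proof -
  have "\<not> a \<le> bot"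
    using assms unfolding all_atoms_def by (simp add: bot_unique)
  then show ?thesis
    using height_sup_atom[OF assms] by fastforce
qed

lemma is_basis_atom:
  fixes a :: "'a::finite_modular_complemented_lattice"
  assumes "a \<in> all_atoms"
  shows "is_basis {a} a"
  using assms height_atom[OF assms] unfolding is_basis_def atoms_below_def by auto

text \<open>Guarantees that the minimum in \<open>mu\<close> ranges over a nonempty set.\<close>

lemma is_basis_exists:
  fixes A :: "'a::finite_modular_complemented_lattice"
  shows "\<exists>\<beta>. is_basis \<beta> A"
proof (induction A rule: atom_induct)
  case bot
  have "is_basis {} (bot::'a)"
    unfolding is_basis_def by simp
  then show ?case by blast
next
  case (sup_atom A a)
  then show ?case
    using is_basis_union(1) is_basis_atom inf_atom by blast
qed

lemma height_Sup_atoms_le: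
  fixes \<beta> :: "'a::finite_modular_complemented_lattice set"
  assumes "\<beta> \<subseteq> all_atoms"
  shows "height (Sup \<beta>) \<le> card \<beta>"
  using finite[of \<beta>] assms
proof (induction \<beta> rule: finite_induct)
  case empty
  then show ?case by simp
next
  case (insert b \<beta>)
  show ?case
  proof (cases "b \<le> Sup \<beta>")
    case True
    then show ?thesis using insert by (simp add: sup_absorb2)
  next
    case False
    then have "height (sup (Sup \<beta>) b) = Suc (height (Sup \<beta>))"
      using insert.prems by (intro height_sup_atom) auto
    then show ?thesis using insert by (simp add: sup_commute)
  qed
qed

text \<open>Without \<open>b\<close> there are too few atoms to reach the height of
  \<open>A\<close>, so \<open>b\<close> is not below the join of the others, and that join has
  height exactly one less.\<close>

lemma is_basis_remove:
  fixes A :: "'a::finite_modular_complemented_lattice"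
  assumes "is_basis \<beta> A" "b \<in> \<beta>"
  shows "is_basis (\<beta> - {b}) (Sup (\<beta> - {b}))" "sup (Sup (\<beta> - {b})) b = A"
    "\<not> b \<le> Sup (\<beta> - {b})"
proof -
  let ?\<gamma> = "\<beta> - {b}"
  have \<beta>: "\<beta> \<subseteq> all_atoms" "card \<beta> = height A" "Sup \<beta> = A"
    using assms unfolding is_basis_def atoms_below_def by auto
  have card: "card \<beta> = Suc (card ?\<gamma>)"
    using assms(2) by (metis card.remove finite)
  show A: "sup (Sup ?\<gamma>) b = A"
    using \<beta>(3) assms(2) by (metis Sup_insert insert_Diff sup_commute)
  have le: "height (Sup ?\<gamma>) \<le> card ?\<gamma>"
    using \<beta>(1) by (intro height_Sup_atoms_le) auto
  show nb: "\<not> b \<le> Sup ?\<gamma>"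
    using le A card \<beta>(2) by (metis Suc_n_not_le_n sup_absorb1)
  have "height A = Suc (height (Sup ?\<gamma>))"
    using height_sup_atom[OF _ nb] A \<beta>(1) assms(2) by auto
  then show "is_basis ?\<gamma> (Sup ?\<gamma>)"
    using card \<beta> unfolding is_basis_def atoms_below_def by (auto intro: Sup_upper)
qed

section \<open>Minimum weight bases\<close>

text \<open>The separate value at \<open>bot\<close> fits the general formula: the only basis of
  \<open>bot\<close> is empty, with sum 0.\<close>

lemma mu_eq_Min:
  fixes A :: "'a::finite_lattice_complete"
  shows "mu f A = Min {sum f \<beta> | \<beta>. is_basis \<beta> A}"
proof (cases "A = bot")
  case True
  have "is_basis \<beta> (bot::'a) \<longleftrightarrow> \<beta> = {}" for \<beta>
    unfolding is_basis_def by auto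
  then show ?thesis
    using True unfolding mu_def by simp
next
  case False
  then show ?thesis
    unfolding mu_def is_basis_def by simp
qed

lemma mu_le:
  fixes A :: "'a::finite_lattice_complete"
  assumes "is_basis \<beta> A"
  shows "mu f A \<le> sum f \<beta>"
  unfolding mu_eq_Min by (rule Min_le) (use assms in auto)

lemma mu_attained:
  fixes A :: "'a::finite_modular_complemented_lattice"
  obtains \<beta> where "is_basis \<beta> A" "mu f A = sum f \<beta>"
proof -
  have "mu f A \<in> {sum f \<beta> | \<beta>. is_basis \<beta> A}"
    unfolding mu_eq_Min by (rule Min_in) (use is_basis_exists[of A] in auto)
  then show ?thesis using that by blast
qed

lemma mu_atom:
  fixes a :: "'a::finite_modular_complemented_lattice"
  assumes a: "a \<in> all_atoms"
  shows "mu f a = f a"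
proof -
  obtain \<beta> where \<beta>: "is_basis \<beta> a" "mu f a = sum f \<beta>"
    by (rule mu_attained)
  have "\<beta> \<subseteq> {a}"
    using \<beta>(1) a unfolding is_basis_def atoms_below_def all_atoms_def
    by (auto simp: order.order_iff_strict)
  moreover have "card \<beta> = 1"
    using \<beta>(1) height_atom[OF a] unfolding is_basis_def by simp
  ultimately have "\<beta> = {a}"
    by (metis card.empty subset_singletonD zero_neq_one)
  then show ?thesis using \<beta>(2) by simp
qed

lemma mu_nonneg:
  fixes A :: "'a::finite_modular_complemented_lattice"
  assumes "\<forall>a\<in>all_atoms. 0 \<le> f a"
  shows "0 \<le> mu f A"
proof -
  obtain \<beta> where \<beta>: "is_basis \<beta> A" "mu f A = sum f \<beta>"
    by (rule mu_attained)
  then show ?thesis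
    using assms unfolding is_basis_def atoms_below_def by (auto intro: sum_nonneg)
qed

lemma mu_sup_disjoint_le:
  fixes A B :: "'a::finite_modular_complemented_lattice"
  assumes "inf A B = bot"
  shows "mu f (sup A B) \<le> mu f A + mu f B"
proof -
  obtain \<alpha> where \<alpha>: "is_basis \<alpha> A" "mu f A = sum f \<alpha>"
    by (rule mu_attained)
  obtain \<beta> where \<beta>: "is_basis \<beta> B" "mu f B = sum f \<beta>"
    by (rule mu_attained)
  show ?thesis
    using mu_le[OF is_basis_union(1)[OF \<alpha>(1) \<beta>(1) assms], of f]
      is_basis_union(2)[OF \<alpha>(1) \<beta>(1) assms] \<alpha>(2) \<beta>(2)
    by (simp add: sum.union_disjoint)
qed

text \<open>Quasi-modularity puts every atom \<open>c\<close> into some minimum weight basis; exchanging it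
  for another atom outside the complementary hyperplane cannot lower the weight.\<close>

lemma quasi_modular_weight_le:
  fixes B :: "'a::finite_modular_complemented_lattice"
  assumes qm: "quasi_modular_below (mu f) B"
    and c: "c \<in> all_atoms" "c \<le> Sup \<gamma>"
    and \<gamma>: "\<gamma> \<subseteq> all_atoms" "Sup \<gamma> \<le> B"
  obtains b where "b \<in> \<gamma>" "f c \<le> f b"
proof -
  have cB: "c \<le> B"
    using c(2) \<gamma>(2) by (rule order.trans)
  obtain cc where cc: "inf cc c = bot" "sup cc c = top" "mu f B = mu f c + mu f (inf B cc)"
    using qm cB unfolding quasi_modular_below_def complements_def by blast
  define H where "H = inf B cc"
  have HB: "sup H c = B"
    using modular_law[OF cB, of cc] cc(2) unfolding H_def by (simp add: sup_commute inf_commute)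
  have "inf H c = bot"
    using cc(1) unfolding H_def by (simp add: inf_assoc)
  then have "\<not> c \<le> H"
    using c(1) unfolding all_atoms_def by (auto simp: inf_absorb2)
  then have "\<not> Sup \<gamma> \<le> H"
    using c(2) by (meson order.trans)
  then obtain b where b: "b \<in> \<gamma>" "\<not> b \<le> H"
    by (meson Sup_least)
  have "b \<le> sup H c"
    using b(1) \<gamma>(2) HB by (metis Sup_upper order.trans)
  then have "B = sup H b"
    using sup_atom_exchange[OF c(1)] b(2) HB by simp
  moreover have "b \<in> all_atoms"
    using b(1) \<gamma>(1) by blast
  ultimately have "mu f B \<le> mu f H + f b"
    using mu_sup_disjoint_le[OF inf_atom, of b H f] b(2) mu_atom[of b f] by simp
  then have "f c \<le> f b"
    using cc(3) mu_atom[OF c(1), of f] unfolding H_def by simp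
  then show ?thesis using that b(1) by blast
qed

text \<open>Removing a heaviest atom \<open>b\<close> from a minimum weight basis of
  \<open>Q\<close> leaves \<open>Q'\<close> of smaller height. Either \<open>P\<close> lies below
  \<open>Q'\<close>, or \<open>P\<close> is its trace on \<open>Q'\<close> plus one atom weighing at
  most \<open>f b\<close>.\<close>

lemma mu_mono_quasi_modular:
  fixes B P Q :: "'a::finite_modular_complemented_lattice"
  assumes f: "\<forall>a\<in>all_atoms. 0 \<le> f a"
    and qm: "quasi_modular_below (mu f) B"
    and "P \<le> Q" "Q \<le> B"
  shows "mu f P \<le> mu f Q"
  using assms(3,4)
proof (induction "height Q" arbitrary: P Q)
  case 0
  obtain \<beta> where "is_basis \<beta> Q"
    using is_basis_exists by blast
  then have "Q = bot"
    using 0(1) unfolding is_basis_def by force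
  then show ?case
    using 0 by (simp add: bot_unique)
next
  case (Suc n)
  obtain \<beta> where \<beta>: "is_basis \<beta> Q" "mu f Q = sum f \<beta>"
    by (rule mu_attained)
  have atoms: "\<beta> \<subseteq> all_atoms" "Sup \<beta> = Q"
    using \<beta>(1) unfolding is_basis_def atoms_below_def by auto
  have "\<beta> \<noteq> {}"
    using \<beta>(1) Suc(2) unfolding is_basis_def by auto
  then have "Max (f ` \<beta>) \<in> f ` \<beta>"
    by (intro Max_in) auto
  then obtain b where b: "b \<in> \<beta>" "f b = Max (f ` \<beta>)"
    by auto
  \<comment> \<open>By \<open>quasi_modular_weight_le\<close> each atom below \<open>Q\<close> is at
    most as heavy as some member of \<open>\<beta>\<close>, so \<open>b\<close> is heaviest among
    all of them.\<close>
  have max_b: "f c \<le> f b" if c: "c \<in> all_atoms" "c \<le> Q" for c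
  proof -
    have "c \<le> Sup \<beta>" "Sup \<beta> \<le> B"
      using c(2) atoms(2) Suc.prems(2) by auto
    then obtain b' where "b' \<in> \<beta>" "f c \<le> f b'"
      using quasi_modular_weight_le[OF qm c(1) _ atoms(1)] by blast
    then show ?thesis
      using b(2) by (metis Max_ge finite finite_imageI imageI order.trans)
  qed
  define Q' where "Q' = Sup (\<beta> - {b})"
  note rem = is_basis_remove[OF \<beta>(1) b(1), folded Q'_def]
  have muQ: "mu f Q' + f b \<le> mu f Q"
    using mu_le[OF rem(1), of f] \<beta>(2) sum.remove[of \<beta> b f] b(1) by simp
  have hQ': "n = height Q'"
    using height_sup_atom[of b Q'] rem atoms(1) b(1) Suc(2) by auto
  have Q'B: "Q' \<le> B"
    using rem(2) Suc.prems(2) by (metis le_sup_iff)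
  show ?case
  proof (cases "P \<le> Q'")
    case True
    have "0 \<le> f b"
      using f atoms(1) b(1) by blast
    then show ?thesis
      using Suc(1)[OF hQ' True Q'B] muQ by simp
  next
    case False
    then obtain c where c: "c \<in> all_atoms" "c \<le> P" "\<not> c \<le> Q'"
      using exists_atom_le_not_le by blast
    have "c \<le> sup Q' b"
      using c(2) Suc.prems(1) rem(2) by simp
    \<comment> \<open>By exchange \<open>c\<close> can replace \<open>b\<close> above
      \<open>Q'\<close>; the modular law then shows that \<open>inf P Q'\<close> and
      \<open>c\<close> span \<open>P\<close>.\<close>
    then have "sup Q' c = Q"
      using sup_atom_exchange[of b c Q'] c(3) rem(2) atoms(1) b(1) by auto
    then have "P = sup (inf P Q') c"
      using modular_law[OF c(2), of Q'] Suc.prems(1)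
      by (simp add: sup_commute inf_commute inf_absorb1)
    moreover have "inf (inf P Q') c = bot"
      using inf_atom[OF c(1,3)] by (simp add: inf_assoc)
    ultimately have "mu f P \<le> mu f (inf P Q') + mu f c"
      using mu_sup_disjoint_le by metis
    also have "\<dots> \<le> mu f Q' + f b"
      using Suc(1)[OF hQ' inf_le2 Q'B] max_b[OF c(1) order.trans[OF c(2) Suc.prems(1)]]
      unfolding mu_atom[OF c(1)] by (rule add_mono)
    finally show ?thesis using muQ by simp
  qed
qed

section \<open>Complements inside an interval\<close>

text \<open>The traces on \<open>Y\<close> of the members of \<open>rel_complements Z Y\<close>.\<close>

definition interval_complement ::
  "'a::bounded_lattice \<Rightarrow> 'a \<Rightarrow> 'a \<Rightarrow> bool" where
  "interval_complement Z Y B \<longleftrightarrow> B \<le> Y \<and> inf B Z = bot \<and> sup B (inf Y Z) = Y"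

lemma rel_complements_imp_interval_complement:
  assumes "Zc \<in> rel_complements Z Y"
  shows "interval_complement Z Y (inf Y Zc)"
proof -
  have "inf (inf Y Zc) Z = bot"
    using assms unfolding rel_complements_def complements_def
    by (simp add: inf_assoc)
  then show ?thesis
    using assms unfolding rel_complements_def interval_complement_def
    by (simp add: inf_commute)
qed

text \<open>Adjoining to \<open>B\<close> a complement \<open>E\<close> of \<open>sup B Z\<close>
  gives a complement of \<open>Z\<close> in the whole lattice, and modularity keeps its trace on
  \<open>Y\<close> equal to \<open>B\<close>.\<close>

lemma interval_complement_imp_rel_complements:
  fixes Y Z B :: "'a::finite_modular_complemented_lattice"
  assumes "interval_complement Z Y B"
  obtains Zc where "Zc \<in> rel_complements Z Y" "inf Y Zc = B"
proof -
  have B: "B \<le> Y" "inf B Z = bot" "sup B (inf Y Z) = Y"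
    using assms unfolding interval_complement_def by auto
  obtain E where E: "inf E (sup B Z) = bot" "sup E (sup B Z) = top"
    using complement_exists by blast
  let ?C = "sup B E"
  have "inf ?C (sup B Z) = B"
    using E(1) by (intro modular_disjoint) auto
  then have CZ: "inf ?C Z = bot"
    using B(2) by (metis inf_assoc inf_sup_absorb sup_commute inf_commute)
  have CZ_top: "sup ?C Z = top"
    using E(2) by (simp add: ac_simps)
  have "inf (sup B (inf Y Z)) ?C = B"
  proof -
    have "inf (inf Y Z) ?C = bot"
      using CZ by (metis inf_bot_right inf_commute inf_left_commute)
    then show ?thesis
      by (intro modular_disjoint) auto
  qed
  then have YC: "inf Y ?C = B"
    using B(3) by simp
  then have "?C \<in> rel_complements Z Y"
    using CZ CZ_top B(3) unfolding rel_complements_def complements_def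
    by (simp add: inf_commute)
  then show ?thesis using that YC by blast
qed

lemma interval_complement_extend:
  fixes Y Z D :: "'a::finite_modular_complemented_lattice"
  assumes "D \<le> Y" "inf D Z = bot"
  obtains B where "interval_complement Z Y B" "D \<le> B"
proof -
  have "sup D (inf Y Z) \<le> Y"
    using assms by simp
  then obtain E where E: "E \<le> Y" "inf (sup D (inf Y Z)) E = bot" "sup (sup D (inf Y Z)) E = Y"
    using relative_complement_exists by blast
  let ?B = "sup D E"
  have BY: "?B \<le> Y"
    using assms E by simp
  have "inf ?B (sup D (inf Y Z)) = D"
    using E(2) by (intro modular_disjoint) (auto simp: inf_commute)
  then have "inf ?B (inf Y Z) = inf D (inf Y Z)"
    by (metis inf_assoc inf_sup_absorb sup_commute inf_commute)
  then have "inf ?B Z = bot"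
    using BY assms by (metis inf.absorb1 inf_assoc inf_commute)
  moreover have "sup ?B (inf Y Z) = Y"
    using E(3) by (simp add: ac_simps)
  ultimately show ?thesis
    using that[of ?B] BY unfolding interval_complement_def by simp
qed

section \<open>Weights of complements under (Z1)\<close>

lemma Z1_for_interval_complement:
  fixes Y Z B Zc :: "'a::finite_modular_complemented_lattice"
  assumes "Z1_for ZZ lam f Y Z" "Zc \<in> rel_complements Z Y" "interval_complement Z Y B"
  shows "mu f B = mu f (inf Y Zc)" "quasi_modular_below (mu f) B"
proof -
  obtain C where C: "C \<in> rel_complements Z Y" "inf Y C = B"
    using interval_complement_imp_rel_complements[OF assms(3)] .
  \<comment> \<open>By clause (i) of (Z1) both sides equal \<open>rho\<close>, so
    \<open>lam Z\<close> cancels.\<close>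
  have "lam Z + mu f (inf Y C) = lam Z + mu f (inf Y Zc)"
    using assms(1,2) C(1) unfolding Z1_for_def by metis
  then show "mu f B = mu f (inf Y Zc)"
    using C(2) by simp
  show "quasi_modular_below (mu f) B"
    using assms(1) C unfolding Z1_for_def by blast
qed

text \<open>\<open>P\<close> grows to a complement \<open>P'\<close> of \<open>Z\<close> in
  \<open>N\<close>, and \<open>P'\<close> to a complement \<open>B\<close> of \<open>Z\<close> in
  \<open>Y\<close>. Quasi-modularity below \<open>B\<close> splits off \<open>P'\<close> with
  equality and leaves \<open>J\<close>; monotonicity passes from \<open>P'\<close> down to
  \<open>P\<close>.\<close>

lemma Z1_for_split:
  fixes Y Z N P Zc :: "'a::finite_modular_complemented_lattice"
  assumes f: "\<forall>a\<in>all_atoms. 0 \<le> f a"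
    and Z: "Z1_for ZZ lam f Y Z" "Zc \<in> rel_complements Z Y"
    and N: "inf Y Z \<le> N" "N \<le> Y"
    and P: "P \<le> N" "inf P Z = bot"
  obtains J where "J \<le> Y" "inf J N = bot" "sup J N = Y" "mu f P + mu f J \<le> mu f (inf Y Zc)"
proof -
  obtain P' where P': "interval_complement Z N P'" "P \<le> P'"
    using interval_complement_extend[OF P] .
  have P'N: "P' \<le> N" "inf P' Z = bot" "sup P' (inf N Z) = N"
    using P'(1) unfolding interval_complement_def by auto
  have "P' \<le> Y"
    using P'N(1) N(2) by (rule order.trans)
  then obtain B where B: "interval_complement Z Y B" "P' \<le> B"
    using interval_complement_extend P'N(2) by blast
  have B': "B \<le> Y" "inf B Z = bot" "sup B (inf Y Z) = Y"
    using B(1) unfolding interval_complement_def by auto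
  note qm = Z1_for_interval_complement(2)[OF Z B(1)]
  obtain C where C: "inf C P' = bot" "sup C P' = top" "mu f B = mu f P' + mu f (inf B C)"
    using qm B(2) unfolding quasi_modular_below_def complements_def by blast
  define J where "J = inf B C"
  \<comment> \<open>\<open>B\<close> meets \<open>N\<close> in nothing beyond \<open>P'\<close>,
    which makes the remainder \<open>J\<close> disjoint from \<open>N\<close>.\<close>
  have "inf (sup P' (inf N Z)) B = P'"
  proof -
    have "inf (inf N Z) B = bot"
      using B'(2) by (metis inf_bot_right inf_commute inf_left_commute)
    then show ?thesis
      using B(2) by (intro modular_disjoint) auto
  qed
  then have "inf N B = P'"
    using P'N(3) by simp
  then have "inf J N = bot"
    unfolding J_def using C(1) by (metis inf_assoc inf_commute)
  moreover have "J \<le> Y"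
    unfolding J_def using B'(1) by (rule le_infI1)
  moreover have "sup J N = Y"
  proof (rule antisym)
    have "B = sup P' J"
      using modular_law[OF B(2), of C] C(2) unfolding J_def
      by (simp add: sup_commute inf_commute)
    then have "B \<le> sup J N"
      using P'N(1) by (simp add: le_supI2)
    moreover have "inf Y Z \<le> sup J N"
      using N(1) by (rule le_supI2)
    ultimately show "Y \<le> sup J N"
      using B'(3) by (metis le_sup_iff)
  qed (use \<open>J \<le> Y\<close> N(2) in simp)
  moreover have "mu f P + mu f J \<le> mu f (inf Y Zc)"
    using mu_mono_quasi_modular[OF f qm P'(2) B(2)] C(3)
      Z1_for_interval_complement(1)[OF Z B(1)] unfolding J_def by simp
  ultimately show ?thesis using that by blast
qed

text \<open>Complements in the successive intervals of
  \<open>inf X (inf Z1 Z2) \<le> inf X Z1 \<le> X\<close> join to a complement across the whole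
  chain, because \<open>sup P Q\<close> meets \<open>Z1\<close> only in \<open>P\<close>.\<close>

lemma interval_complement_inf:
  fixes X Z1 Z2 P Q :: "'a::finite_modular_complemented_lattice"
  assumes "interval_complement Z2 (inf X Z1) P" "interval_complement Z1 X Q"
  shows "interval_complement (inf Z1 Z2) X (sup P Q)"
proof -
  have P: "P \<le> inf X Z1" "inf P Z2 = bot" "sup P (inf (inf X Z1) Z2) = inf X Z1"
    and Q: "Q \<le> X" "inf Q Z1 = bot" "sup Q (inf X Z1) = X"
    using assms unfolding interval_complement_def by auto
  have "inf (sup P Q) Z1 = P"
    using P(1) Q(2) by (intro modular_disjoint) auto
  then have "inf (sup P Q) (inf Z1 Z2) = bot"
    using P(2) by (metis inf_assoc)
  moreover have "sup (sup P Q) (inf X (inf Z1 Z2)) = X"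
    using P(3) Q(3) by (metis inf_assoc sup_assoc sup_commute)
  ultimately show ?thesis
    using P(1) Q(1) unfolding interval_complement_def by simp
qed

theorem theorem5p8:
  fixes ZZ :: "'a::finite_modular_complemented_lattice set"
    and lam f :: "'a \<Rightarrow> real"
    and X a1 a2 Z1 Z2 Z1c Z2c :: 'a
  assumes "lattice_for_inherited_order ZZ"
    and "\<forall>Z\<in>ZZ. 0 \<le> lam Z"
    and "\<forall>a\<in>all_atoms. 0 \<le> f a"
    and "axiom_Z1 ZZ lam f"
    and "a1 \<in> all_atoms - atoms_below X"
    and "a2 \<in> all_atoms - atoms_below X"
    and "Z1 \<in> rho_minimizers ZZ lam f (sup X a1)"
    and "Z1_for ZZ lam f (sup X a1) Z1"
    and "Z2 \<in> rho_minimizers ZZ lam f (sup X a2)"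
    and "Z1_for ZZ lam f (sup X a2) Z2"
    and "Z1c \<in> rel_complements Z1 (sup X a1)"
    and "Z2c \<in> rel_complements Z2 (sup X a2)"
  shows "\<exists>Jc \<in> rel_complements (sup Z1 Z2) (sup (sup X a1) a2).
         \<exists>Mc \<in> rel_complements (inf Z1 Z2) X.
           mu f (inf (sup X a1) Z1c) + mu f (inf (sup X a2) Z2c)
             \<ge> mu f (inf X Mc) + mu f (inf (sup (sup X a1) a2) Jc)"
proof -
  let ?Y1 = "sup X a1" and ?Y2 = "sup X a2" and ?W = "sup (sup X a1) a2" and ?Z = "sup Z1 Z2"
  note f = assms(3)
  have a1: "a1 \<in> all_atoms"
    using assms(5) by simp
  obtain P where P: "interval_complement Z2 (inf X Z1) P"
    using interval_complement_extend[of bot "inf X Z1" Z2] by auto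
  obtain Q where Q: "interval_complement Z1 X Q"
    using interval_complement_extend[of bot X Z1] by auto
  have PX: "P \<le> X" "P \<le> Z1" "inf P Z2 = bot" and QX: "Q \<le> X" "inf Q Z1 = bot"
    using P Q unfolding interval_complement_def by auto
  have "inf P Q = bot"
    using PX(2) QX(2) by (metis bot_unique inf_commute inf_mono order_refl)
  then have muM: "mu f (sup P Q) \<le> mu f P + mu f Q"
    by (rule mu_sup_disjoint_le)
  have PN: "P \<le> inf ?Y2 ?Z"
    using PX by (simp add: le_supI1)
  \<comment> \<open>Here \<open>N\<close> is the trace of \<open>sup Z1 Z2\<close> on
    \<open>sup X a2\<close>.\<close>
  obtain J2 where J2: "J2 \<le> ?Y2" "inf J2 (inf ?Y2 ?Z) = bot" "sup J2 (inf ?Y2 ?Z) = ?Y2"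
    "mu f P + mu f J2 \<le> mu f (inf ?Y2 Z2c)"
    by (rule Z1_for_split[OF f assms(10,12) _ _ PN PX(3)]) (auto intro: le_infI2)
  have J2Z: "inf J2 ?Z = bot"
    using J2(1,2) by (metis inf.absorb1 inf_assoc)
  have Y2W: "?Y2 \<le> ?W"
    by (simp add: le_supI1)
  have "\<exists>J. interval_complement ?Z ?W J \<and>
      mu f P + mu f Q + mu f J \<le> mu f (inf ?Y1 Z1c) + mu f (inf ?Y2 Z2c)"
  \<comment> \<open>\<open>J2\<close> fails to be a complement in \<open>?W\<close> only if
    \<open>a1\<close> enlarges \<open>?Y2\<close> while the trace of \<open>?Z\<close> stays below
    \<open>?Y2\<close>.\<close>
  proof (cases "inf ?W ?Z \<le> ?Y2 \<and> \<not> a1 \<le> ?Y2")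
    case False
    have W: "sup ?Y2 (inf ?W ?Z) = ?W"
    proof (cases "a1 \<le> ?Y2")
      case True
      then have "?W = ?Y2"
        by (intro antisym) (auto intro: le_supI1)
      then show ?thesis by (simp add: sup_absorb1)
    next
      case a1_not: False
      have "inf ?W ?Z \<le> sup ?Y2 a1"
        by (rule le_infI1) (simp add: ac_simps)
      then have "sup ?Y2 (inf ?W ?Z) = sup ?Y2 a1"
        using sup_atom_exchange[OF a1] a1_not False by blast
      then show ?thesis by (simp add: ac_simps)
    qed
    have "inf ?Y2 ?Z \<le> inf ?W ?Z"
      using Y2W by (rule inf_mono) simp
    then have "?Y2 \<le> sup J2 (inf ?W ?Z)"
      using J2(3) by (metis sup_mono order_refl)
    then have "sup J2 (inf ?W ?Z) = ?W"
    proof (intro antisym)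
      show "sup J2 (inf ?W ?Z) \<le> ?W"
        using order.trans[OF J2(1) Y2W] by (rule sup_least) (rule inf_le1)
      show "?W \<le> sup J2 (inf ?W ?Z)"
        using \<open>?Y2 \<le> sup J2 (inf ?W ?Z)\<close> by (subst W[symmetric]) (rule sup_least, auto)
    qed
    then have "interval_complement ?Z ?W J2"
      using J2(1) J2Z Y2W unfolding interval_complement_def by (metis order.trans)
    \<comment> \<open>With \<open>N\<close> equal to \<open>?Y1\<close>, the split bounds
      \<open>mu f Q\<close> alone once the nonnegative \<open>mu f K\<close> is dropped.\<close>
    moreover obtain K where "mu f Q + mu f K \<le> mu f (inf ?Y1 Z1c)"
      by (rule Z1_for_split[OF f assms(8,11) inf_le1 order_refl _ QX(2)])
        (use QX(1) in \<open>auto intro: le_supI1\<close>)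
    ultimately show ?thesis
      using J2(4) mu_nonneg[OF f, of K] by (intro exI[of _ J2]) simp
  next
    case True
    have "inf a1 ?Y2 = bot"
      using inf_atom[OF a1, of ?Y2] True by (simp add: inf_commute)
    then have Y12: "inf ?Y1 ?Y2 = X"
      by (intro modular_disjoint) auto
    \<comment> \<open>The trace of \<open>Z1\<close> on \<open>?Y1\<close> lies below both
      \<open>?Y1\<close> and \<open>?Y2\<close>, hence below \<open>X\<close>, so \<open>X\<close>
      is admissible as \<open>N\<close> and \<open>K\<close> becomes a complement of
      \<open>X\<close> in \<open>?Y1\<close>.\<close>
    have "inf ?Y1 Z1 \<le> inf ?W ?Z"
      by (rule inf_mono) auto
    then have "inf ?Y1 Z1 \<le> X"
      using True Y12 by (metis inf_le1 le_inf_iff order.trans)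
    then obtain K where K: "K \<le> ?Y1" "inf K X = bot" "sup K X = ?Y1"
      "mu f Q + mu f K \<le> mu f (inf ?Y1 Z1c)"
      using Z1_for_split[OF f assms(8,11) _ sup_ge1 QX] by blast
    have KY2: "inf K ?Y2 = bot"
      using K(1,2) Y12 by (metis inf.absorb1 inf_assoc)
    then have "inf J2 K = bot"
      using J2(1) by (metis bot_unique inf_commute inf_mono order_refl)
    then have "mu f (sup J2 K) \<le> mu f J2 + mu f K"
      by (rule mu_sup_disjoint_le)
    moreover have "interval_complement ?Z ?W (sup J2 K)"
    proof -
      have JW: "sup J2 K \<le> ?W"
        using J2(1) K(1) Y2W by (meson le_supI1 le_supI order.trans sup_ge1)
      have WZ: "inf ?W ?Z = inf ?Y2 ?Z"
        using True inf_mono[OF Y2W order_refl, of ?Z] by (intro antisym) simp_all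
      have "inf (sup J2 K) ?Y2 = J2"
        using J2(1) KY2 by (rule modular_disjoint)
      then have "inf (sup J2 K) (inf ?W ?Z) = bot"
        using J2Z WZ by (metis inf_assoc)
      then have "inf (sup J2 K) ?Z = bot"
        using JW by (metis inf.absorb1 inf_assoc)
      moreover have "sup (sup J2 K) (inf ?W ?Z) = ?W"
      proof -
        have "sup (sup J2 K) (inf ?W ?Z) = sup K (sup J2 (inf ?Y2 ?Z))"
          unfolding WZ by (simp only: ac_simps)
        also have "\<dots> = sup K ?Y2"
          unfolding J2(3) ..
        also have "\<dots> = ?W"
          using K(3) by (metis sup_assoc)
        finally show ?thesis .
      qed
      ultimately show ?thesis
        using JW unfolding interval_complement_def by simp
    qed
    ultimately show ?thesis
      using J2(4) K(4) by (intro exI[of _ "sup J2 K"]) simp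
  qed
  then obtain J where J: "interval_complement ?Z ?W J"
    "mu f P + mu f Q + mu f J \<le> mu f (inf ?Y1 Z1c) + mu f (inf ?Y2 Z2c)"
    by blast
  obtain Jc where Jc: "Jc \<in> rel_complements ?Z ?W" "inf ?W Jc = J"
    using interval_complement_imp_rel_complements[OF J(1)] .
  obtain Mc where Mc: "Mc \<in> rel_complements (inf Z1 Z2) X" "inf X Mc = sup P Q"
    using interval_complement_imp_rel_complements[OF interval_complement_inf[OF P Q]] .
  show ?thesis
    by (rule bexI[OF _ Jc(1)], rule bexI[OF _ Mc(1)]) (use Jc(2) Mc(2) J(2) muM in simp)
qed

end
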